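(* Let $0\le a\le b$ and $d>0$, and let $\mathbf{D}=[\mathbf{A}\ \mathbf{B}]\in\mathbb{C}^{M\times N}$ be any dictionary in the set $\mathcal{D}(d,a,b)$, i.e., a dictionary with coherence $d$ that is the concatenation of a sub-dictionary $\mathbf{A}$ with coherence $a$ and a sub-dictionary $\mathbf{B}$ with coherence $b$. Put $\delta=1+b$, $\epsilon=2\sqrt{2}\sqrt{d(b+d)}$ and, for $b<d$, $$\kappa(d,b)=\frac{\delta\sqrt{2d\,(b+3d+\epsilon)}-2d-2b(\delta+d)}{2(d^2-b^2)}.$$ Let $\mathbf{y}\in\mathbb{C}^M$ and let $\mathbf{x}\in\mathbb{C}^N$ satisfy $\mathbf{y}=\mathbf{D}\mathbf{x}$. If $$\|\mathbf{x}\|_0<\begin{cases}\dfrac{\delta\,[\epsilon-(d+3b)]}{2(d^2-b^2)}, & \text{if } b<d \text{ and } \kappa(d,b)>1,\\[8pt] \dfrac{1+2d^2+3b-d\delta}{2(d^2+b)}, & \text{otherwise,}\end{cases}$$ then $\mathbf{x}$ is the unique solution of the problem (P1): minimize $\|\mathbf{x}'\|_1$ over all $\mathbf{x}'\in\mathbb{C}^N$ subject to $\mathbf{y}=\mathbf{D}\mathbf{x}'$.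
   Context: A dictionary is a matrix $\mathbf{D}=[\mathbf{d}_1\ \ldots\ \mathbf{d}_N]\in\mathbb{C}^{M\times N}$ whose columns have unit $\ell_2$-norm and span $\mathbb{C}^M$. A sub-dictionary is a (nonempty) matrix with unit $\ell_2$-norm columns in $\mathbb{C}^M$, not required to span $\mathbb{C}^M$. The coherence of a matrix with unit-norm columns $\mathbf{d}_i$ is $\max_{i\ne j}|\mathbf{d}_i^H\mathbf{d}_j|$, and it is set to $0$ if there is only one column. $\mathcal{D}(d,a,b)$ denotes the set of dictionaries $\mathbf{D}=[\mathbf{A}\ \mathbf{B}]$ with coherence $d$, where the sub-dictionary $\mathbf{A}$ has coherence $a$ and the sub-dictionary $\mathbf{B}$ has coherence $b$; $\mathbf{A}$ and $\mathbf{B}$ need not be orthonormal bases and need not have the same number of columns. (Automatically $a,b\le d\le 1$.) $\|\mathbf{x}\|_0$ is the number of nonzero entries of $\mathbf{x}$, and $\|\mathbf{x}\|_1=\sum_i|x_i|$. *)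

theory Defs
  imports "HOL-Analysis.Analysis"
begin

text \<open>
  Matrices with \<open>M\<close> rows and \<open>N\<close> columns have type \<^typ>\<open>complex ^ 'n ^ 'm\<close> with
  \<open>M = CARD('m)\<close> and \<open>N = CARD('n)\<close>.  Since index types are inhabited, every such matrix is nonempty.
  The norm on \<^typ>\<open>complex ^ 'm\<close> is the \<open>\<ell>\<^sub>2\<close>-norm.
\<close>

definition herm :: "complex ^ 'm \<Rightarrow> complex ^ 'm \<Rightarrow> complex" where
  "herm u v = (\<Sum>k\<in>UNIV. cnj (u $ k) * v $ k)"

definition subdictionary :: "complex ^ 'n ^ 'm \<Rightarrow> bool" where
  "subdictionary A \<longleftrightarrow> (\<forall>i. norm (column i A) = 1)"

text \<open>The span must be taken over the complex scalars, hence \<^const>\<open>vec.span\<close>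
  rather than \<^const>\<open>span\<close>.\<close>

definition dictionary :: "complex ^ 'n ^ 'm \<Rightarrow> bool" where
  "dictionary D \<longleftrightarrow> (\<forall>i. norm (column i D) = 1) \<and> vec.span (columns D) = UNIV"

definition coherence :: "complex ^ 'n ^ 'm \<Rightarrow> real" where
  "coherence A =
    (if CARD('n) = 1 then 0
     else Max {cmod (herm (column i A) (column j A)) | i j. i \<noteq> j})"

definition hconcat :: "'a ^ 'p ^ 'm \<Rightarrow> 'a ^ 'q ^ 'm \<Rightarrow> 'a ^ ('p + 'q) ^ 'm" where
  "hconcat A B = (\<chi> k i. case i of Inl p \<Rightarrow> A $ k $ p | Inr q \<Rightarrow> B $ k $ q)"

definition dictionary_pairs ::
  "real \<Rightarrow> real \<Rightarrow> real \<Rightarrow> (complex ^ ('p::finite + 'q::finite) ^ 'm::finite) set" where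
  "dictionary_pairs d a b =
    {D. dictionary D \<and> coherence D = d \<and>
        (\<exists>A B. D = hconcat A B \<and>
               subdictionary A \<and> coherence A = a \<and>
               subdictionary B \<and> coherence B = b)}"

definition l0norm :: "complex ^ 'n \<Rightarrow> nat" where
  "l0norm x = card {i. x $ i \<noteq> 0}"

definition l1norm :: "complex ^ 'n \<Rightarrow> real" where
  "l1norm x = (\<Sum>i\<in>UNIV. cmod (x $ i))"

definition P1_solutions :: "complex ^ 'n ^ 'm \<Rightarrow> complex ^ 'm \<Rightarrow> (complex ^ 'n) set" where
  "P1_solutions D y = {x. is_arg_min l1norm (\<lambda>x'. y = D *v x') x}"

definition delta :: "real \<Rightarrow> real" where
  "delta b = 1 + b"

definition epsilon :: "real \<Rightarrow> real \<Rightarrow> real" where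
  "epsilon d b = 2 * sqrt 2 * sqrt (d * (b + d))"

text \<open>Only meaningful for \<open>b < d\<close>.\<close>

definition kappa :: "real \<Rightarrow> real \<Rightarrow> real" where
  "kappa d b =
    (delta b * sqrt (2 * d * (b + 3 * d + epsilon d b)) - 2 * d - 2 * b * (delta b + d))
      / (2 * (d\<^sup>2 - b\<^sup>2))"

end

theory Submission
  imports Defs
begin

text \<open>
  A kernel vector \<open>v = (p, q)\<close> of \<open>D\<close>, with \<open>P = \<parallel>p\<parallel>\<^sub>1\<close> and \<open>Q = \<parallel>q\<parallel>\<^sub>1\<close>, satisfies
  \<open>(1 + b) \<bar>p\<^sub>i\<bar> \<le> b P + d Q\<close> and \<open>(1 + b) \<bar>q\<^sub>j\<bar> \<le> b Q + d P\<close>, as one sees by taking inner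
  products of \<open>D v = 0\<close> with the columns.  Suppose that the entries of \<open>v\<close> at \<open>m\<close> columns
  of \<open>A\<close> and \<open>n\<close> columns of \<open>B\<close> carry at least half of the \<open>\<ell>\<^sub>1\<close>-norm of \<open>v\<close>.  Normalise to
  \<open>P + Q = 1\<close> and \<open>Q \<le> P\<close>.  Then it is cheapest to take all of \<open>q\<close>, so that
  \<open>m + n \<ge> (1 + b) ((1/2 - Q) / (b P + d Q) + Q / (b Q + d P))\<close>.
  The first threshold is the minimum of the right-hand side over \<open>Q\<close>, and \<open>\<kappa>\<close> is the number
  \<open>(1 + b) Q / (b Q + d P)\<close> of columns of \<open>B\<close> at the minimiser.  If \<open>\<kappa> \<le> 1\<close>, integrality of \<open>n\<close>
  moves the worst case to the point \<open>Q = d P\<close>, where this number is \<open>1\<close>, and the value there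
  is the second threshold.  So below the thresholds \<open>D\<close> has the null space property on the
  support of \<open>x\<close>.
\<close>

section \<open>Coherence\<close>

lemma cmod_herm_le: "cmod (herm u v) \<le> norm u * norm v"
proof -
  have "cmod (herm u v) \<le> (\<Sum>k\<in>UNIV. \<bar>norm (u $ k)\<bar> * \<bar>norm (v $ k)\<bar>)"
    unfolding herm_def by (rule order_trans[OF norm_sum]) (simp add: norm_mult)
  also have "\<dots> \<le> norm u * norm v"
    unfolding norm_vec_def by (rule L2_set_mult_ineq)
  finally show ?thesis .
qed

lemma herm_self: "herm u u = complex_of_real ((norm u)\<^sup>2)"
proof -
  have "herm u u = (\<Sum>k\<in>UNIV. complex_of_real ((cmod (u $ k))\<^sup>2))"
    unfolding herm_def by (simp only: complex_norm_square mult.commute)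
  also have "\<dots> = complex_of_real ((norm u)\<^sup>2)"
    by (simp add: norm_vec_def L2_set_def sum_nonneg)
  finally show ?thesis .
qed

lemma finite_coherence_set:
  "finite {cmod (herm (column i A) (column j A)) | i j. i \<noteq> j}"
proof -
  have "{cmod (herm (column i A) (column j A)) | i j. i \<noteq> j}
      \<subseteq> (\<lambda>(i, j). cmod (herm (column i A) (column j A))) ` UNIV"
    by auto
  then show ?thesis by (rule finite_subset) simp
qed

lemma card_neq_1_iff_ex_distinct: "CARD('n::finite) \<noteq> 1 \<longleftrightarrow> (\<exists>i j :: 'n. i \<noteq> j)"
proof
  assume "CARD('n) \<noteq> 1"
  show "\<exists>i j :: 'n. i \<noteq> j"
  proof (rule ccontr)
    assume "\<not> ?thesis"
    then have "UNIV = {undefined :: 'n}" by auto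
    then have "CARD('n) = card {undefined :: 'n}" by simp
    with \<open>CARD('n) \<noteq> 1\<close> show False by simp
  qed
next
  show "\<exists>i j :: 'n. i \<noteq> j \<Longrightarrow> CARD('n) \<noteq> 1"
    by (metis UNIV_I card_1_singletonE singletonD)
qed

lemma coherence_ge:
  assumes "i \<noteq> j"
  shows "cmod (herm (column i A) (column j A)) \<le> coherence A"
proof -
  have "CARD('a) \<noteq> 1" using assms card_neq_1_iff_ex_distinct by blast
  then show ?thesis
    unfolding coherence_def using assms by (auto intro!: Max_ge finite_coherence_set)
qed

text \<open>The bound \<open>0 \<le> c\<close> covers a single column, whose coherence is 0 by
  convention.\<close>

lemma coherence_le:
  assumes "0 \<le> c" and "\<And>i j. i \<noteq> j \<Longrightarrow> cmod (herm (column i A) (column j A)) \<le> c"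
  shows "coherence A \<le> c"
proof (cases "\<exists>i j :: 'a. i \<noteq> j")
  case True
  then have "{cmod (herm (column i A) (column j A)) | i j. i \<noteq> j} \<noteq> {}" by blast
  moreover have "CARD('a) \<noteq> 1" using True card_neq_1_iff_ex_distinct by blast
  ultimately show ?thesis
    unfolding coherence_def using assms(2) by (auto simp: Max_le_iff finite_coherence_set)
next
  case False
  then have "CARD('a) = 1" using card_neq_1_iff_ex_distinct by blast
  then show ?thesis using assms(1) by (simp add: coherence_def)
qed

lemma column_hconcat [simp]:
  "column (Inl i) (hconcat A B) = column i A"
  "column (Inr j) (hconcat A B) = column j B"
  by (simp_all add: column_def hconcat_def vec_eq_iff)

section \<open>Kernel vectors\<close>

lemma sum_UNIV_Plus:
  fixes f :: "'p::finite + 'q::finite \<Rightarrow> 'b::comm_monoid_add"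
  shows "(\<Sum>i\<in>UNIV. f i) = (\<Sum>i\<in>UNIV. f (Inl i)) + (\<Sum>j\<in>UNIV. f (Inr j))"
  using sum.Plus[of UNIV UNIV f] by (simp add: UNIV_Plus_UNIV o_def)

text \<open>Row \<open>i\<close> of the Gram matrix annihilates \<open>v\<close> and has diagonal
  entry 1; isolate that term and apply the triangle inequality.\<close>

lemma kernel_entry_le:
  assumes "D *v v = 0" and "norm (column i D) = 1"
  shows "cmod (v $ i) \<le> (\<Sum>j\<in>UNIV - {i}. cmod (herm (column i D) (column j D)) * cmod (v $ j))"
proof -
  let ?h = "\<lambda>j. herm (column i D) (column j D)"
  have "(\<Sum>j\<in>UNIV. ?h j * v $ j) = (\<Sum>k\<in>UNIV. cnj (D $ k $ i) * (D *v v) $ k)"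
    unfolding herm_def column_def matrix_vector_mult_def
    by (simp add: sum_distrib_left sum_distrib_right mult.assoc) (rule sum.swap)
  then have "(\<Sum>j\<in>UNIV. ?h j * v $ j) = 0"
    using assms(1) by simp
  moreover have "(\<Sum>j\<in>UNIV. ?h j * v $ j) = v $ i + (\<Sum>j\<in>UNIV - {i}. ?h j * v $ j)"
    using assms(2) by (simp add: sum.remove[of UNIV i] herm_self)
  ultimately have "v $ i = - (\<Sum>j\<in>UNIV - {i}. ?h j * v $ j)"
    by (simp add: eq_neg_iff_add_eq_0)
  then have "cmod (v $ i) = cmod (\<Sum>j\<in>UNIV - {i}. ?h j * v $ j)"
    by simp
  also have "\<dots> \<le> (\<Sum>j\<in>UNIV - {i}. cmod (?h j) * cmod (v $ j))"
    by (rule order_trans[OF norm_sum]) (simp add: norm_mult)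
  finally show ?thesis .
qed

text \<open>Correlations within the first block are at most \<open>b\<close>, those across blocks at
  most \<open>d\<close>. The diagonal term missing from the first sum moves to the left and makes
  the factor \<open>1 + b\<close>.\<close>

lemma hconcat_kernel_entry_le_Inl:
  fixes A :: "complex ^ 'p::finite ^ 'm::finite" and B :: "complex ^ 'q::finite ^ 'm"
  assumes ker: "hconcat A B *v v = 0" and unit: "norm (column i A) = 1"
    and coh: "coherence A \<le> b" "coherence (hconcat A B) \<le> d"
  shows "(1 + b) * cmod (v $ Inl i)
    \<le> b * (\<Sum>j\<in>UNIV. cmod (v $ Inl j)) + d * (\<Sum>j\<in>UNIV. cmod (v $ Inr j))"
proof -
  let ?D = "hconcat A B"
  \<comment> \<open>Weight 0 at \<open>Inl i\<close> lets the sum be extended to all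
    indices.\<close>
  let ?c = "\<lambda>j. if j = Inl i then 0 else case j of Inl _ \<Rightarrow> b | Inr _ \<Rightarrow> d"
  have "cmod (herm (column (Inl i) ?D) (column j ?D)) \<le> ?c j" if "j \<noteq> Inl i" for j
  proof (cases j)
    case (Inl k)
    then show ?thesis using that coherence_ge[of i k A] coh(1) by auto
  next
    case (Inr k)
    then show ?thesis using coherence_ge[of "Inl i" "Inr k" ?D] coh(2) by simp
  qed
  then have "(\<Sum>j\<in>UNIV - {Inl i}. cmod (herm (column (Inl i) ?D) (column j ?D)) * cmod (v $ j))
      \<le> (\<Sum>j\<in>UNIV - {Inl i}. ?c j * cmod (v $ j))"
    by (intro sum_mono mult_right_mono) auto
  also have "\<dots> = (\<Sum>j\<in>UNIV. ?c j * cmod (v $ j))"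
    by (rule sum.mono_neutral_left) auto
  also have "\<dots> = (\<Sum>j\<in>UNIV. b * cmod (v $ Inl j) - (if j = i then b * cmod (v $ Inl i) else 0))
      + (\<Sum>j\<in>UNIV. d * cmod (v $ Inr j))"
    by (subst sum_UNIV_Plus) (auto intro!: arg_cong2[where f = "(+)"] sum.cong)
  also have "\<dots> = b * (\<Sum>j\<in>UNIV. cmod (v $ Inl j)) - b * cmod (v $ Inl i)
      + d * (\<Sum>j\<in>UNIV. cmod (v $ Inr j))"
    by (simp add: sum_subtractf sum_distrib_left)
  finally show ?thesis
    using kernel_entry_le[OF ker, of "Inl i"] unit by (simp add: algebra_simps)
qed

section \<open>Exchanging the two blocks of columns\<close>

definition swap_sum :: "'a ^ ('p::finite + 'q::finite) \<Rightarrow> 'a ^ ('q + 'p)" where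
  "swap_sum v = (\<chi> i. case i of Inl q \<Rightarrow> v $ Inr q | Inr p \<Rightarrow> v $ Inl p)"

lemma hconcat_swap_sum:
  fixes A :: "complex ^ 'p::finite ^ 'm::finite" and B :: "complex ^ 'q::finite ^ 'm"
  shows "hconcat B A *v swap_sum v = hconcat A B *v v"
  by (simp add: vec_eq_iff matrix_vector_mult_def sum_UNIV_Plus hconcat_def swap_sum_def add.commute)

lemma coherence_hconcat_swap_le:
  fixes A :: "complex ^ 'p::finite ^ 'm::finite" and B :: "complex ^ 'q::finite ^ 'm"
  shows "coherence (hconcat B A) \<le> coherence (hconcat A B)"
proof (rule coherence_le)
  show "0 \<le> coherence (hconcat A B)"
    using coherence_ge[of "Inl undefined" "Inr undefined" "hconcat A B"]
    by (meson Inl_Inr_False norm_ge_zero order_trans)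
next
  fix i j :: "'q + 'p"
  let ?t = "\<lambda>i :: 'q + 'p. case i of Inl q \<Rightarrow> Inr q | Inr p \<Rightarrow> Inl p"
  assume "i \<noteq> j"
  then have "?t i \<noteq> ?t j" by (auto split: sum.splits)
  moreover have "column k (hconcat B A) = column (?t k) (hconcat A B)" for k
    by (cases k) auto
  ultimately show "cmod (herm (column i (hconcat B A)) (column j (hconcat B A)))
      \<le> coherence (hconcat A B)"
    using coherence_ge by metis
qed

text \<open>Columns of \<open>B\<close> form the first block of \<open>hconcat B A\<close>, whose
  kernel contains the reordered vector \<open>swap_sum v\<close>, so the bound for first blocks
  applies.\<close>

lemma hconcat_kernel_entry_le_Inr:
  fixes A :: "complex ^ 'p::finite ^ 'm::finite" and B :: "complex ^ 'q::finite ^ 'm"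
  assumes "hconcat A B *v v = 0" and "norm (column i B) = 1"
    and "coherence B \<le> b" "coherence (hconcat A B) \<le> d"
  shows "(1 + b) * cmod (v $ Inr i)
    \<le> b * (\<Sum>j\<in>UNIV. cmod (v $ Inr j)) + d * (\<Sum>j\<in>UNIV. cmod (v $ Inl j))"
  using hconcat_kernel_entry_le_Inl[of B A "swap_sum v" i b d] assms
    order_trans[OF coherence_hconcat_swap_le[of B A] assms(4)]
  by (simp add: hconcat_swap_sum) (simp add: swap_sum_def)

section \<open>The threshold\<close>

definition sparsity_threshold :: "real \<Rightarrow> real \<Rightarrow> real" where
  "sparsity_threshold d b =
    (if b < d \<and> kappa d b > 1
     then delta b * (epsilon d b - (d + 3 * b)) / (2 * (d\<^sup>2 - b\<^sup>2))
     else (1 + 2 * d\<^sup>2 + 3 * b - d * delta b) / (2 * (d\<^sup>2 + b)))"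

section \<open>Lower bounds for the cost of half the mass\<close>

text \<open>The cost of taking all of \<open>q\<close> and the rest from \<open>p\<close>, in units of \<open>1 + b\<close>.\<close>

definition cost :: "real \<Rightarrow> real \<Rightarrow> real \<Rightarrow> real" where
  "cost d b Q = (1 / 2 - Q) / (b * (1 - Q) + d * Q) + Q / (b * Q + d * (1 - Q))"

text \<open>Exchange argument: a unit of mass costs \<open>1 / \<alpha>\<close> in \<open>p\<close>
  and at most that, \<open>1 / \<beta>\<close>, in \<open>q\<close>. Raising \<open>q\<close> to
  \<open>Q\<close> and lowering \<open>p\<close> to \<open>1 / 2 - Q\<close> thus never costs
  more.\<close>

lemma cost_le_ratios:
  assumes "0 < \<alpha>" "\<alpha> \<le> \<beta>" "q \<le> Q" "1 / 2 \<le> p + q"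
    and "\<alpha> = b * (1 - Q) + d * Q" "\<beta> = b * Q + d * (1 - Q)"
  shows "cost d b Q \<le> p / \<alpha> + q / \<beta>"
proof -
  have "1 / \<beta> \<le> 1 / \<alpha>" using assms by (simp add: frac_le)
  then have "(Q - q) * (1 / \<beta>) \<le> (Q - q) * (1 / \<alpha>)"
    using assms by (intro mult_left_mono) auto
  moreover have "(1 / 2 - q) / \<alpha> \<le> p / \<alpha>"
    using assms by (intro divide_right_mono) auto
  ultimately show ?thesis
    unfolding cost_def assms(5,6)[symmetric] by (simp add: diff_divide_distrib)
qed

text \<open>Cauchy-Schwarz for two terms; after clearing denominators the two sides differ by
  \<open>(u * \<beta> - w * \<alpha>)\<^sup>2\<close>.\<close>

lemma sum_squares_divide_ge:
  fixes \<alpha> \<beta> u w :: real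
  assumes "0 < \<alpha>" "0 < \<beta>"
  shows "(u + w)\<^sup>2 / (\<alpha> + \<beta>) \<le> u\<^sup>2 / \<alpha> + w\<^sup>2 / \<beta>"
proof -
  have "0 \<le> (u * \<beta> - w * \<alpha>)\<^sup>2" by simp
  then have "(u + w)\<^sup>2 * (\<alpha> * \<beta>) \<le> (u\<^sup>2 * \<beta> + w\<^sup>2 * \<alpha>) * (\<alpha> + \<beta>)"
    by (simp add: power2_eq_square algebra_simps)
  moreover have "u\<^sup>2 / \<alpha> + w\<^sup>2 / \<beta> = (u\<^sup>2 * \<beta> + w\<^sup>2 * \<alpha>) / (\<alpha> * \<beta>)"
    using assms by (simp add: field_simps)
  ultimately show ?thesis
    using assms by (simp add: field_simps)
qed

text \<open>Minimisation over \<open>Q\<close> without calculus: \<open>(d - b) * cost d b Q\<close>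
  equals \<open>s / 2 / \<alpha> + d / \<beta> - 2\<close>, where
  \<open>\<alpha> + \<beta> = s\<close> does not depend on \<open>Q\<close>, so Cauchy-Schwarz
  applies.\<close>

lemma cost_ge_epsilon:
  assumes "0 \<le> b" "b < d" "0 \<le> Q" "Q \<le> 1 / 2" "0 < b * (1 - Q) + d * Q"
  shows "(epsilon d b - (d + 3 * b)) / (2 * (d\<^sup>2 - b\<^sup>2)) \<le> cost d b Q"
proof -
  define s where "s = b + d"
  define \<alpha> where "\<alpha> = b * (1 - Q) + d * Q"
  define \<beta> where "\<beta> = b * Q + d * (1 - Q)"
  have pos: "0 < s" "0 < d - b" "0 < \<alpha>" "\<alpha> + \<beta> = s"
    using assms by (auto simp: s_def \<alpha>_def \<beta>_def algebra_simps)
  have "0 < \<beta>"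
    using assms unfolding \<beta>_def by (intro add_nonneg_pos) auto
  \<comment> \<open>Half of \<open>epsilon d b\<close> is the cross term of the square
    \<open>(sqrt (s / 2) + sqrt d)\<^sup>2\<close>.\<close>
  have sq: "sqrt (s / 2) * sqrt d * 4 = epsilon d b"
  proof -
    have "sqrt (s / 2) = sqrt 2 * sqrt s / 2" by (simp add: real_sqrt_divide real_div_sqrt field_simps)
    then show ?thesis by (simp add: epsilon_def s_def real_sqrt_mult mult_ac add.commute)
  qed
  have "(sqrt (s / 2) + sqrt d)\<^sup>2 = s / 2 + d + epsilon d b / 2"
    unfolding sq[symmetric] using assms pos by (simp add: power2_sum)
  then have cs: "(s / 2 + d + epsilon d b / 2) / s \<le> s / 2 / \<alpha> + d / \<beta>"
    using sum_squares_divide_ge[OF \<open>0 < \<alpha>\<close> \<open>0 < \<beta>\<close>, of "sqrt (s / 2)" "sqrt d"] pos assms by simp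
  have "cost d b Q = (s / 2 / \<alpha> + d / \<beta> - 2) / (d - b)"
  proof -
    have "(d - b) * (1 / 2 - Q) = s / 2 - \<alpha>" "(d - b) * Q = d - \<beta>"
      by (auto simp: s_def \<alpha>_def \<beta>_def field_simps)
    then have "(d - b) * ((1 / 2 - Q) / \<alpha> + Q / \<beta>) = (s / 2 - \<alpha>) / \<alpha> + (d - \<beta>) / \<beta>"
      by (simp add: distrib_left)
    also have "\<dots> = s / 2 / \<alpha> + d / \<beta> - 2"
      using pos \<open>0 < \<beta>\<close> by (simp add: diff_divide_distrib)
    finally show ?thesis
      unfolding cost_def \<alpha>_def[symmetric] \<beta>_def[symmetric] using pos
      by (simp add: eq_divide_eq mult.commute)
  qed
  also have "\<dots> \<ge> ((s / 2 + d + epsilon d b / 2) / s - 2) / (d - b)"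
    using cs pos by (intro divide_right_mono) auto
  also have "((s / 2 + d + epsilon d b / 2) / s - 2) / (d - b)
      = (epsilon d b - (d + 3 * b)) / (2 * (s * (d - b)))"
    using pos by (simp add: field_simps) (simp add: s_def)
  also have "s * (d - b) = d\<^sup>2 - b\<^sup>2"
    by (simp add: s_def power2_eq_square algebra_simps)
  finally show ?thesis .
qed

text \<open>The difference quotient of \<open>cost\<close> between \<open>Q\<^sub>1\<close> and
  \<open>Q\<close> is \<open>d / (\<beta> * \<beta>\<^sub>1) - (b + d) / (2 * (\<alpha> *
  \<alpha>\<^sub>1))\<close>. As \<open>Q\<close> grows, \<open>\<alpha>\<close> does not decrease
  and \<open>\<beta>\<close> does not increase, so it is enough that the derivative at
  \<open>Q\<^sub>1\<close> is nonnegative, which is \<open>slope\<close>.\<close>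

lemma cost_mono:
  assumes "0 \<le> b" "b \<le> d" "0 < d" "0 \<le> Q\<^sub>1" "Q\<^sub>1 \<le> Q" "Q \<le> 1 / 2"
    and \<alpha>\<^sub>1: "\<alpha>\<^sub>1 = b * (1 - Q\<^sub>1) + d * Q\<^sub>1" and \<beta>\<^sub>1: "\<beta>\<^sub>1 = b * Q\<^sub>1 + d * (1 - Q\<^sub>1)"
    and "0 < \<alpha>\<^sub>1" and slope: "(b + d) * \<beta>\<^sub>1\<^sup>2 \<le> 2 * d * \<alpha>\<^sub>1\<^sup>2"
  shows "cost d b Q\<^sub>1 \<le> cost d b Q"
proof -
  define \<alpha> where "\<alpha> = b * (1 - Q) + d * Q"
  define \<beta> where "\<beta> = b * Q + d * (1 - Q)"
  have "(d - b) * Q\<^sub>1 \<le> (d - b) * Q"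
    using assms by (intro mult_left_mono) auto
  then have le: "\<alpha>\<^sub>1 \<le> \<alpha>" "\<beta> \<le> \<beta>\<^sub>1"
    by (auto simp: \<alpha>\<^sub>1 \<alpha>_def \<beta>\<^sub>1 \<beta>_def algebra_simps)
  have "0 < \<beta>"
    using assms unfolding \<beta>_def by (intro add_nonneg_pos) auto
  have "0 < \<alpha>" "0 < \<beta>\<^sub>1"
    using le \<open>0 < \<alpha>\<^sub>1\<close> \<open>0 < \<beta>\<close> by linarith+
  note pos = \<open>0 < \<alpha>\<close> \<open>0 < \<beta>\<close> \<open>0 < \<alpha>\<^sub>1\<close> \<open>0 < \<beta>\<^sub>1\<close>
  have "(b + d) * (\<beta> * \<beta>\<^sub>1) \<le> (b + d) * (\<beta>\<^sub>1 * \<beta>\<^sub>1)"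
    using assms le pos by (intro mult_left_mono mult_right_mono) auto
  also have "\<dots> \<le> 2 * d * (\<alpha>\<^sub>1 * \<alpha>\<^sub>1)"
    using slope by (simp add: power2_eq_square)
  also have "\<dots> \<le> 2 * d * (\<alpha> * \<alpha>\<^sub>1)"
    using assms le pos by (intro mult_left_mono mult_right_mono) auto
  finally have "0 \<le> d / (\<beta> * \<beta>\<^sub>1) - (b + d) / (2 * (\<alpha> * \<alpha>\<^sub>1))"
    using pos by (simp add: field_simps)
  then have "0 \<le> (Q - Q\<^sub>1) * (d / (\<beta> * \<beta>\<^sub>1) - (b + d) / (2 * (\<alpha> * \<alpha>\<^sub>1)))"
    using assms by simp
  also have "\<dots> = cost d b Q - cost d b Q\<^sub>1"
  proof -
    have "(1 / 2 - Q) / \<alpha> - (1 / 2 - Q\<^sub>1) / \<alpha>\<^sub>1 = ((1 / 2 - Q) * \<alpha>\<^sub>1 - (1 / 2 - Q\<^sub>1) * \<alpha>) / (\<alpha> * \<alpha>\<^sub>1)"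
      using pos by (simp add: field_simps)
    moreover have "(1 / 2 - Q) * \<alpha>\<^sub>1 - (1 / 2 - Q\<^sub>1) * \<alpha> = - ((Q - Q\<^sub>1) * ((b + d) / 2))"
      unfolding \<alpha>_def \<alpha>\<^sub>1 by (simp add: field_simps)
    moreover have "Q / \<beta> - Q\<^sub>1 / \<beta>\<^sub>1 = (Q * \<beta>\<^sub>1 - Q\<^sub>1 * \<beta>) / (\<beta> * \<beta>\<^sub>1)"
      using pos by (simp add: field_simps)
    moreover have "Q * \<beta>\<^sub>1 - Q\<^sub>1 * \<beta> = (Q - Q\<^sub>1) * d"
      unfolding \<beta>_def \<beta>\<^sub>1 by (simp add: algebra_simps)
    ultimately have "((1 / 2 - Q) / \<alpha> - (1 / 2 - Q\<^sub>1) / \<alpha>\<^sub>1) + (Q / \<beta> - Q\<^sub>1 / \<beta>\<^sub>1)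
        = (Q - Q\<^sub>1) * (d / (\<beta> * \<beta>\<^sub>1) - (b + d) / (2 * (\<alpha> * \<alpha>\<^sub>1)))"
      by (simp add: right_diff_distrib)
    then show ?thesis
      unfolding cost_def \<alpha>_def[symmetric] \<beta>_def[symmetric] \<alpha>\<^sub>1[symmetric] \<beta>\<^sub>1[symmetric] by simp
  qed
  finally show ?thesis by simp
qed

section \<open>What the condition on \<open>kappa\<close> says about the cost\<close>

lemma kappa_eq:
  assumes "0 \<le> b" "0 < d"
  shows "kappa d b = delta b * (sqrt (2 * d * (b + d)) - 2 * b) / (2 * (d\<^sup>2 - b\<^sup>2))"
proof -
  have e: "epsilon d b = 2 * (sqrt (2 * d) * sqrt (b + d))"
    by (simp add: epsilon_def real_sqrt_mult)
  \<comment> \<open>A perfect square, which removes the nested root.\<close>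
  have "b + 3 * d + epsilon d b = (sqrt (b + d) + sqrt (2 * d))\<^sup>2"
    unfolding e using assms by (simp add: power2_sum)
  then have "sqrt (2 * d * (b + 3 * d + epsilon d b)) = sqrt (2 * d) * (sqrt (b + d) + sqrt (2 * d))"
    using assms by (simp add: real_sqrt_mult)
  also have "\<dots> = sqrt (2 * d * (b + d)) + 2 * d"
    using assms by (simp add: distrib_left real_sqrt_mult[symmetric])
  finally show ?thesis
    unfolding kappa_def by (simp add: delta_def algebra_simps)
qed

text \<open>This is \<open>slope\<close> of \<open>cost_mono\<close> at
  \<open>Q\<^sub>1 = d / (1 + d)\<close>, multiplied by \<open>(1 + d)\<^sup>2\<close>. For
  \<open>b < d\<close> it comes from squaring \<open>kappa d b \<le> 1\<close>; for
  \<open>b = d\<close> both sides agree.\<close>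

lemma slope_condition:
  assumes "0 \<le> b" "b \<le> d" "0 < d" "\<not> (b < d \<and> kappa d b > 1)"
  shows "(b + d) * (d * (1 + b))\<^sup>2 \<le> 2 * d * (b + d\<^sup>2)\<^sup>2"
proof (cases "b = d")
  case True
  then show ?thesis by (simp add: power2_eq_square algebra_simps)
next
  case False
  then have "b < d" "kappa d b \<le> 1" using assms by auto
  then have "0 < d\<^sup>2 - b\<^sup>2" using assms by (simp add: power_strict_mono)
  then have "delta b * (sqrt (2 * d * (b + d)) - 2 * b) \<le> 2 * (d\<^sup>2 - b\<^sup>2)"
    using \<open>kappa d b \<le> 1\<close> assms by (simp add: kappa_eq)
  then have "(1 + b) * sqrt (2 * d * (b + d)) \<le> 2 * (b + d\<^sup>2)"
    by (simp add: delta_def power2_eq_square algebra_simps)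
  then have "((1 + b) * sqrt (2 * d * (b + d)))\<^sup>2 \<le> (2 * (b + d\<^sup>2))\<^sup>2"
    using assms by (intro power_mono) auto
  then have "(1 + b)\<^sup>2 * (2 * d * (b + d)) \<le> 4 * (b + d\<^sup>2)\<^sup>2"
    using assms by (simp add: power_mult_distrib del: distrib_left_numeral)
  then have "d / 2 * ((1 + b)\<^sup>2 * (2 * d * (b + d))) \<le> d / 2 * (4 * (b + d\<^sup>2)\<^sup>2)"
    using assms by (intro mult_left_mono) auto
  moreover have "d / 2 * ((1 + b)\<^sup>2 * (2 * d * (b + d))) = (b + d) * (d * (1 + b))\<^sup>2"
    by (simp add: power2_eq_square)
  moreover have "d / 2 * (4 * (b + d\<^sup>2)\<^sup>2) = 2 * d * (b + d\<^sup>2)\<^sup>2"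
    by simp
  ultimately show ?thesis by metis
qed

text \<open>The counting argument in normalised form: the first threshold follows from the minimum
  of \<open>cost\<close> alone, the second also uses that \<open>n\<close> is an integer.\<close>

lemma sparsity_threshold_le:
  fixes m n :: nat
  assumes bd: "0 \<le> b" "b \<le> d" "0 < d" "d \<le> 1"
    and PQ: "P + Q = 1" "0 \<le> Q" "Q \<le> P"
    and pq: "0 \<le> p" "0 \<le> q" "q \<le> Q" "1 / 2 \<le> p + q"
    and m: "(1 + b) * p \<le> real m * (b * P + d * Q)"
    and n: "(1 + b) * q \<le> real n * (b * Q + d * P)"
  shows "sparsity_threshold d b \<le> real m + real n"
proof -
  define \<alpha> where "\<alpha> = b * (1 - Q) + d * Q"
  define \<beta> where "\<beta> = b * Q + d * (1 - Q)"
  have P: "P = 1 - Q" and "Q \<le> 1 / 2" using PQ by auto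
  have "(d - b) * Q \<le> (d - b) * (1 - Q)"
    using bd \<open>Q \<le> 1 / 2\<close> by (intro mult_left_mono) auto
  then have "\<alpha> \<le> \<beta>" by (simp add: \<alpha>_def \<beta>_def algebra_simps)
  \<comment> \<open>Otherwise \<open>Q = 0\<close> and the bound on \<open>p\<close> forces
    \<open>p \<le> 0\<close>, leaving no half of the mass.\<close>
  have "0 < \<alpha>"
  proof (rule ccontr)
    assume "\<not> 0 < \<alpha>"
    moreover have "0 \<le> b * P" "0 \<le> d * Q" using bd PQ by auto
    ultimately have "d * Q = 0" "b * P + d * Q = 0" unfolding \<alpha>_def P by linarith+
    then have "Q = 0" "(1 + b) * p \<le> 0" using bd m by auto
    then have "p \<le> 0" using bd by (simp add: mult_le_0_iff)
    then show False using pq \<open>Q = 0\<close> by simp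
  qed
  with \<open>\<alpha> \<le> \<beta>\<close> have "0 < \<beta>" by simp
  have m': "(1 + b) * (p / \<alpha>) \<le> real m"
    using m \<open>0 < \<alpha>\<close> by (simp add: \<alpha>_def P pos_divide_le_eq)
  have n': "(1 + b) * (q / \<beta>) \<le> real n"
    using n \<open>0 < \<beta>\<close> by (simp add: \<beta>_def P pos_divide_le_eq)
  have "cost d b Q \<le> p / \<alpha> + q / \<beta>"
    using \<open>0 < \<alpha>\<close> \<open>\<alpha> \<le> \<beta>\<close> pq by (intro cost_le_ratios) (auto simp: \<alpha>_def \<beta>_def)
  then have "(1 + b) * cost d b Q \<le> (1 + b) * (p / \<alpha> + q / \<beta>)"
    using bd by (intro mult_left_mono) auto
  with m' n' have cost: "(1 + b) * cost d b Q \<le> real m + real n"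
    by (simp add: distrib_left)
  show ?thesis
  proof (cases "b < d \<and> kappa d b > 1")
    case True
    have "(1 + b) * ((epsilon d b - (d + 3 * b)) / (2 * (d\<^sup>2 - b\<^sup>2))) \<le> (1 + b) * cost d b Q"
      using True bd PQ \<open>Q \<le> 1 / 2\<close> \<open>0 < \<alpha>\<close>
      by (intro mult_left_mono cost_ge_epsilon) (auto simp: \<alpha>_def)
    with cost True show ?thesis by (simp add: sparsity_threshold_def delta_def)
  next
    case False
    \<comment> \<open>Solution of \<open>Q = d * (1 - Q)\<close>, where \<open>(1 + b) * Q\<close>
      equals the bound for one column of \<open>B\<close>.\<close>
    define Q\<^sub>1 where "Q\<^sub>1 = d / (1 + d)"
    define \<alpha>\<^sub>1 where "\<alpha>\<^sub>1 = b * (1 - Q\<^sub>1) + d * Q\<^sub>1"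
    define \<beta>\<^sub>1 where "\<beta>\<^sub>1 = b * Q\<^sub>1 + d * (1 - Q\<^sub>1)"
    have compl: "1 - Q\<^sub>1 = 1 / (1 + d)"
      using bd by (simp add: Q\<^sub>1_def field_simps)
    have \<alpha>\<^sub>1: "\<alpha>\<^sub>1 = (b + d\<^sup>2) / (1 + d)" and \<beta>\<^sub>1: "\<beta>\<^sub>1 = d * (1 + b) / (1 + d)"
      unfolding \<alpha>\<^sub>1_def \<beta>\<^sub>1_def compl
      by (simp_all add: Q\<^sub>1_def power2_eq_square distrib_left add_divide_distrib mult.commute)
    have "0 < b + d\<^sup>2" using bd by (intro add_nonneg_pos) auto
    then have "0 < \<alpha>\<^sub>1" using bd by (simp add: \<alpha>\<^sub>1)
    have Q\<^sub>1: "0 \<le> Q\<^sub>1" "Q\<^sub>1 \<le> 1 / 2" using bd by (auto simp: Q\<^sub>1_def field_simps)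
    have "(b + d) * \<beta>\<^sub>1\<^sup>2 \<le> 2 * d * \<alpha>\<^sub>1\<^sup>2"
      using divide_right_mono[OF slope_condition[OF bd(1-3) False], of "(1 + d)\<^sup>2"]
      by (simp add: \<alpha>\<^sub>1 \<beta>\<^sub>1 power_divide)
    then have mono: "cost d b Q\<^sub>1 \<le> cost d b R" if "Q\<^sub>1 \<le> R" "R \<le> 1 / 2" for R
      using that bd Q\<^sub>1 \<open>0 < \<alpha>\<^sub>1\<close> by (intro cost_mono) (auto simp: \<alpha>\<^sub>1_def \<beta>\<^sub>1_def)
    \<comment> \<open>One column of \<open>B\<close>, plus the remaining mass taken from
      \<open>A\<close> at \<open>Q\<^sub>1\<close>.\<close>
    have threshold: "sparsity_threshold d b = 1 + (1 + b) * ((1 / 2 - Q\<^sub>1) / \<alpha>\<^sub>1)"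
    proof -
      have "1 / 2 - Q\<^sub>1 = (1 - d) / 2 / (1 + d)"
        using bd by (simp add: Q\<^sub>1_def field_simps)
      then have slack: "(1 / 2 - Q\<^sub>1) / \<alpha>\<^sub>1 = (1 - d) / (2 * (b + d\<^sup>2))"
        using bd by (simp add: \<alpha>\<^sub>1 del: distrib_left_numeral)
      have "sparsity_threshold d b = (1 + 2 * d\<^sup>2 + 3 * b - d * (1 + b)) / (2 * (b + d\<^sup>2))"
        using False by (auto simp: sparsity_threshold_def delta_def add.commute)
      also have "\<dots> = 1 + (1 + b) * ((1 - d) / (2 * (b + d\<^sup>2)))"
        using \<open>0 < b + d\<^sup>2\<close> by (simp add: field_simps)
      finally show ?thesis unfolding slack .
    qed
    have "(1 + b) * (Q\<^sub>1 / \<beta>\<^sub>1) = 1"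
      using bd by (simp add: \<beta>\<^sub>1 Q\<^sub>1_def)
    then have threshold': "sparsity_threshold d b = (1 + b) * cost d b Q\<^sub>1"
      unfolding threshold cost_def \<alpha>\<^sub>1_def[symmetric] \<beta>\<^sub>1_def[symmetric] distrib_left by (simp only: add.commute)
    show ?thesis
    proof (cases "n = 0")
      case True
      have "(1 + b) * q \<le> 0" using n True by simp
      then have "q \<le> 0" using bd by (simp add: mult_le_0_iff)
      \<comment> \<open>Without columns of \<open>B\<close> all of the half lies in
        \<open>p\<close>. Compare with \<open>Q = 1 / 2\<close>, where both denominators are
        \<open>(b + d) / 2\<close>, the mean of \<open>\<alpha>\<close> and \<open>\<beta>\<close>
        and so at least \<open>\<alpha>\<close>.\<close>
      have "cost d b (1 / 2) = (1 / 2) / ((b + d) / 2)"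
        by (simp add: cost_def add_divide_distrib)
      also have "\<dots> \<le> p / \<alpha>"
        using \<open>0 < \<alpha>\<close> \<open>\<alpha> \<le> \<beta>\<close> pq \<open>q \<le> 0\<close>
        by (intro frac_le) (auto simp: \<alpha>_def \<beta>_def algebra_simps)
      finally have "cost d b Q\<^sub>1 \<le> p / \<alpha>"
        using mono[of "1 / 2"] Q\<^sub>1 by simp
      then have "(1 + b) * cost d b Q\<^sub>1 \<le> (1 + b) * (p / \<alpha>)"
        using bd by (intro mult_left_mono) auto
      then show ?thesis unfolding threshold' using m' True by linarith
    next
      case n: False
      show ?thesis
      proof (cases "Q\<^sub>1 \<le> Q")
        case True
        have "(1 + b) * cost d b Q\<^sub>1 \<le> (1 + b) * cost d b Q"
          using bd mono[OF True \<open>Q \<le> 1 / 2\<close>] by (intro mult_left_mono) auto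
        then show ?thesis unfolding threshold' using cost by linarith
      next
        case False
        \<comment> \<open>Left of \<open>Q\<^sub>1\<close> monotonicity is of no help, but
          \<open>n \<ge> 1\<close> pays for the summand 1, and \<open>p\<close> must be at least
          \<open>1 / 2 - Q\<^sub>1\<close> with a smaller or equal denominator.\<close>
        have "(d - b) * Q \<le> (d - b) * Q\<^sub>1"
          using bd False by (intro mult_left_mono) auto
        then have "\<alpha> \<le> \<alpha>\<^sub>1" by (simp add: \<alpha>_def \<alpha>\<^sub>1_def algebra_simps)
        then have "(1 / 2 - Q\<^sub>1) / \<alpha>\<^sub>1 \<le> p / \<alpha>"
          using False pq \<open>0 < \<alpha>\<close> Q\<^sub>1 by (intro frac_le) auto
        then have "(1 + b) * ((1 / 2 - Q\<^sub>1) / \<alpha>\<^sub>1) \<le> (1 + b) * (p / \<alpha>)"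
          using bd by (intro mult_left_mono) auto
        moreover have "1 \<le> real n" using n by simp
        ultimately show ?thesis unfolding threshold using m' by linarith
      qed
    qed
  qed
qed

text \<open>The hypotheses are homogeneous and symmetric in the two blocks: divide by
  \<open>P + Q\<close> and let the heavier block come first.\<close>

lemma half_mass_imp_sparsity_threshold_le:
  fixes m n :: nat
  assumes bd: "0 \<le> b" "b \<le> d" "0 < d" "d \<le> 1"
    and PQ: "0 \<le> P" "0 \<le> Q" "0 < P + Q"
    and pq: "0 \<le> p" "p \<le> P" "0 \<le> q" "q \<le> Q" "P + Q \<le> 2 * (p + q)"
    and m: "(1 + b) * p \<le> real m * (b * P + d * Q)"
    and n: "(1 + b) * q \<le> real n * (b * Q + d * P)"
  shows "sparsity_threshold d b \<le> real m + real n"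
proof -
  define t where "t = P + Q"
  have "0 < t" using PQ by (simp add: t_def)
  have 1: "P / t + Q / t = 1"
    using \<open>0 < t\<close> by (simp add: add_divide_distrib[symmetric] t_def[symmetric])
  have 2: "0 \<le> P / t" "0 \<le> Q / t" "0 \<le> p / t" "0 \<le> q / t" "p / t \<le> P / t" "q / t \<le> Q / t"
    using PQ pq \<open>0 < t\<close> by (auto intro: divide_right_mono)
  have 3: "1 / 2 \<le> p / t + q / t"
    using pq \<open>0 < t\<close> by (simp add: add_divide_distrib[symmetric] t_def[symmetric] field_simps)
  have 4: "(1 + b) * (p / t) \<le> real m * (b * (P / t) + d * (Q / t))"
    "(1 + b) * (q / t) \<le> real n * (b * (Q / t) + d * (P / t))"
    using divide_right_mono[OF m, of t] divide_right_mono[OF n, of t] \<open>0 < t\<close>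
    by (simp_all add: add_divide_distrib[symmetric])
  show ?thesis
  proof (cases "Q \<le> P")
    case True
    then have "Q / t \<le> P / t" using \<open>0 < t\<close> by (intro divide_right_mono) auto
    then show ?thesis by (rule sparsity_threshold_le[OF bd 1 2(2) _ 2(3,4,6) 3 4])
  next
    case False
    then have "P / t \<le> Q / t" using \<open>0 < t\<close> by (intro divide_right_mono) auto
    then have "sparsity_threshold d b \<le> real n + real m"
      using 1 3 by (intro sparsity_threshold_le[OF bd _ 2(1) _ 2(4,3,5) _ 4(2,1)]) auto
    then show ?thesis by simp
  qed
qed

section \<open>The null space property\<close>

text \<open>Off the support of \<open>x\<close> the difference equals \<open>x'\<close>; on it,
  passing to \<open>x'\<close> loses at most the mass of the difference there, which is less than
  half of the total.\<close>

lemma l1norm_less_of_null_space: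
  assumes half: "2 * (\<Sum>i\<in>{i. x $ i \<noteq> 0}. cmod ((x' - x) $ i)) < l1norm (x' - x)"
  shows "l1norm x < l1norm x'"
proof -
  let ?S = "{i. x $ i \<noteq> 0}"
  let ?v = "x' - x"
  have split: "(\<Sum>i\<in>UNIV. f i) = (\<Sum>i\<in>?S. f i) + (\<Sum>i\<in>-?S. f i)" for f :: "_ \<Rightarrow> real"
    by (subst sum.union_disjoint[symmetric]) (auto intro: sum.cong)
  have "(\<Sum>i\<in>?S. cmod (x $ i)) \<le> (\<Sum>i\<in>?S. cmod (x' $ i) + cmod (?v $ i))"
    by (intro sum_mono) (simp add: norm_minus_commute norm_triangle_sub)
  moreover have "(\<Sum>i\<in>-?S. cmod (x $ i)) = 0" "(\<Sum>i\<in>-?S. cmod (?v $ i)) = (\<Sum>i\<in>-?S. cmod (x' $ i))"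
    by (auto intro: sum.cong)
  ultimately show ?thesis
    using half unfolding l1norm_def split by (simp add: sum.distrib)
qed

text \<open>Using \<open>b\<close> for both blocks makes them interchangeable. Summing the entry
  bounds over the part of \<open>S\<close> in each block gives the counting hypotheses.\<close>

lemma null_space_property:
  fixes A :: "complex ^ 'p::finite ^ 'm::finite" and B :: "complex ^ 'q::finite ^ 'm"
  assumes bd: "0 \<le> b" "b \<le> d" "0 < d" "d \<le> 1"
    and coh: "coherence A \<le> b" "coherence B \<le> b" "coherence (hconcat A B) \<le> d"
    and unit: "subdictionary A" "subdictionary B"
    and ker: "hconcat A B *v v = 0" and "v \<noteq> 0"
    and card: "real (card S) < sparsity_threshold d b"
  shows "2 * (\<Sum>i\<in>S. cmod (v $ i)) < l1norm v"
proof (rule ccontr)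
  assume half: "\<not> 2 * (\<Sum>i\<in>S. cmod (v $ i)) < l1norm v"
  define P where "P = (\<Sum>j\<in>UNIV. cmod (v $ Inl j))"
  define Q where "Q = (\<Sum>j\<in>UNIV. cmod (v $ Inr j))"
  let ?SA = "Inl -` S" and ?SB = "Inr -` S"
  have S: "S = ?SA <+> ?SB"
  proof (rule set_eqI)
    show "i \<in> S \<longleftrightarrow> i \<in> ?SA <+> ?SB" for i by (cases i) auto
  qed
  have sumS: "(\<Sum>i\<in>S. cmod (v $ i)) = (\<Sum>i\<in>?SA. cmod (v $ Inl i)) + (\<Sum>i\<in>?SB. cmod (v $ Inr i))"
    by (subst S, subst sum.Plus) auto
  have cardS: "card S = card ?SA + card ?SB"
    by (subst S, subst card_Plus) auto
  have l1: "l1norm v = P + Q"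
    unfolding l1norm_def P_def Q_def by (rule sum_UNIV_Plus)
  have "0 < P + Q"
  proof -
    obtain i where "v $ i \<noteq> 0" using \<open>v \<noteq> 0\<close> by (auto simp: vec_eq_iff)
    then have "0 < l1norm v"
      unfolding l1norm_def by (intro sum_pos2[of _ i]) auto
    then show ?thesis by (simp add: l1)
  qed
  have m: "(1 + b) * (\<Sum>i\<in>?SA. cmod (v $ Inl i)) \<le> real (card ?SA) * (b * P + d * Q)"
    unfolding P_def Q_def using unit
    by (subst sum_distrib_left,
        intro sum_bounded_above hconcat_kernel_entry_le_Inl[OF ker _ coh(1,3)])
      (simp add: subdictionary_def)
  have n: "(1 + b) * (\<Sum>i\<in>?SB. cmod (v $ Inr i)) \<le> real (card ?SB) * (b * Q + d * P)"
    unfolding P_def Q_def using unit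
    by (subst sum_distrib_left,
        intro sum_bounded_above hconcat_kernel_entry_le_Inr[OF ker _ coh(2,3)])
      (simp add: subdictionary_def)
  have le: "(\<Sum>i\<in>?SA. cmod (v $ Inl i)) \<le> P" "(\<Sum>i\<in>?SB. cmod (v $ Inr i)) \<le> Q"
    unfolding P_def Q_def by (auto intro: sum_mono2)
  have "sparsity_threshold d b \<le> real (card ?SA) + real (card ?SB)"
    using half l1 sumS \<open>0 < P + Q\<close> le
    by (intro half_mass_imp_sparsity_threshold_le[OF bd _ _ _ _ _ _ _ _ m n])
      (auto simp: P_def Q_def intro: sum_nonneg)
  then show False using card by (simp add: cardS)
qed

theorem theorem2:
  fixes D :: "complex ^ ('p::finite + 'q::finite) ^ 'm::finite"
    and x :: "complex ^ ('p + 'q)" and y :: "complex ^ 'm"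
    and d a b :: real
  assumes "0 \<le> a" and "a \<le> b" and "0 < d"
    and "D \<in> dictionary_pairs d a b"
    and "y = D *v x"
    and "real (l0norm x) <
      (if b < d \<and> kappa d b > 1
       then delta b * (epsilon d b - (d + 3 * b)) / (2 * (d\<^sup>2 - b\<^sup>2))
       else (1 + 2 * d\<^sup>2 + 3 * b - d * delta b) / (2 * (d\<^sup>2 + b)))"
  shows "P1_solutions D y = {x}"
proof -
  obtain A :: "complex ^ 'p ^ 'm" and B :: "complex ^ 'q ^ 'm" where
    D: "D = hconcat A B" "dictionary D" "coherence D = d" and
    AB: "subdictionary A" "coherence A = a" "subdictionary B" "coherence B = b"
    using assms(4) by (auto simp: dictionary_pairs_def)
  \<comment> \<open>The bounds \<open>d \<le> 1\<close> and \<open>b \<le> d\<close> follow from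
    unit columns and from \<open>B\<close> being a block of \<open>D\<close>.\<close>
  have "coherence D \<le> 1"
  proof (rule coherence_le)
    show "cmod (herm (column i D) (column j D)) \<le> 1" for i j
      using cmod_herm_le[of "column i D" "column j D"] D(2) by (simp add: dictionary_def)
  qed simp
  have "coherence B \<le> coherence D"
  proof (rule coherence_le)
    show "cmod (herm (column i B) (column j B)) \<le> coherence D" if "i \<noteq> j" for i j
      using coherence_ge[of "Inr i" "Inr j" D] that D(1) by simp
  qed (use assms(3) D(3) in simp)
  have less: "l1norm x < l1norm x'" if "y = D *v x'" "x' \<noteq> x" for x'
  proof (rule l1norm_less_of_null_space, rule null_space_property)
    show "hconcat A B *v (x' - x) = 0"
      using that(1) assms(5) D(1) by (simp add: matrix_vector_mult_diff_distrib)
    show "real (card {i. x $ i \<noteq> 0}) < sparsity_threshold d b"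
      using assms(6) by (simp add: l0norm_def sparsity_threshold_def)
  qed (use assms(1-3) D AB that \<open>coherence D \<le> 1\<close> \<open>coherence B \<le> coherence D\<close> in auto)
  have "is_arg_min l1norm (\<lambda>x'. y = D *v x') x' \<longleftrightarrow> x' = x" for x'
    unfolding is_arg_min_def using less assms(5) by (metis less_asym' less_irrefl)
  then show ?thesis by (simp add: P1_solutions_def)
qed

end
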